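(* There is no finitely generated decidable group presentation $P$ that has solvable word problem, solvable bounded word problem, and non-computable Dehn function. Also, there is no finitely generated decidable group presentation $P$ that has unsolvable word problem, solvable bounded word problem, and computable Dehn function.
   Context: A presentation $P=\langle X\,\|\,R\rangle$ consists of a finite or countable set $X$ of generators and a set $R$ of relators, which are nonempty cyclically reduced words over $X^{\pm1}$, with $R$ closed under taking inverses and cyclic conjugates; it presents $F(X)/\langle\langle R\rangle\rangle$. $P$ is finitely generated if $X$ is finite, and decidable if $X$ and $R$ are decidable sets. The word problem for $P$ is solvable if the language of words in $F(X)$ trivial in $P$ is decidable. The area of a van Kampen diagram is its number of 2-cells. The bounded word problem for $P$ is solvable if the language of pairs $(w,n)$, where $w$ is a trivial word, $n$ is a positive integer written in unary, and there exists a van Kampen diagram over $P$ with boundary label $w$ and area not exceeding $n$, is decidable. A function $f:\mathbf{N}\to\mathbf{N}$ is an isoperimetric function of $P$ if for every $n$ and every word $w$ trivial in $P$ with $|w|<n$ there is a van Kampen diagram over $P$ with boundary label $w$ and area $<f(n)$; the Dehn function of $P$ is the smallest isoperimetric function. The Dehn function $f$ is computable if the language of pairs $(n,f(n))$, written in binary, is decidable. *)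

theory Defs
  imports
    "HOL-Library.Nat_Bijection"
    "HOL-Combinatorics.Orbits"
    "HOL-Algebra.Coset"
begin

section \<open>Decidability\<close>

text \<open>
  The general recursive functions of arity \<open>k\<close>, as total functions of an argument list of
  length \<open>k\<close>.  Minimization is applied to regular functions only, so that every function in the
  class is total; by Kleene's normal form theorem these are exactly the total computable functions.
  Values on lists whose length differs from the arity carry no meaning.
\<close>

inductive recursive :: "nat \<Rightarrow> (nat list \<Rightarrow> nat) \<Rightarrow> bool" where
  zero: "recursive k (\<lambda>xs. 0)"
| suc: "recursive 1 (\<lambda>xs. Suc (xs ! 0))"
| proj: "i < k \<Longrightarrow> recursive k (\<lambda>xs. xs ! i)"
| comp: "recursive (length gs) f \<Longrightarrow> (\<And>g. g \<in> set gs \<Longrightarrow> recursive k g) \<Longrightarrow>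
    recursive k (\<lambda>xs. f (map (\<lambda>g. g xs) gs))"
| prec: "recursive k f \<Longrightarrow> recursive (k + 2) g \<Longrightarrow>
    recursive (Suc k) (\<lambda>xs. rec_nat (f (tl xs)) (\<lambda>y r. g (y # r # tl xs)) (hd xs))"
| mu: "recursive (Suc k) f \<Longrightarrow> (\<And>xs. length xs = k \<Longrightarrow> \<exists>y. f (y # xs) = 0) \<Longrightarrow>
    recursive k (\<lambda>xs. LEAST y. f (y # xs) = 0)"

definition decidable :: "nat set \<Rightarrow> bool" where
  "decidable A \<longleftrightarrow> (\<exists>f. recursive 1 f \<and> (\<forall>n. f [n] = of_bool (n \<in> A)))"

text \<open>
  Strings over the natural numbers are coded by the (computable) bijection \<^const>\<open>list_encode\<close>,
  pairs by \<^const>\<open>prod_encode\<close>.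
\<close>

definition unary :: "nat \<Rightarrow> nat list" where
  "unary n = replicate n 1"

fun binary :: "nat \<Rightarrow> nat list" where
  "binary n = (if n < 2 then [n] else binary (n div 2) @ [n mod 2])"

declare binary.simps [simp del]


section \<open>Words and free groups\<close>

text \<open>\<open>(x, True)\<close> stands for the generator \<open>x\<close> and \<open>(x, False)\<close> for its formal inverse.\<close>

type_synonym letter = "nat \<times> bool"
type_synonym word = "letter list"

definition inv_letter :: "letter \<Rightarrow> letter" where
  "inv_letter a = (fst a, \<not> snd a)"

definition inv_word :: "word \<Rightarrow> word" where
  "inv_word w = rev (map inv_letter w)"

definition words :: "nat set \<Rightarrow> word set" where
  "words X = lists (X \<times> UNIV)"

definition reduced :: "word \<Rightarrow> bool" where
  "reduced w \<longleftrightarrow> successively (\<lambda>a b. b \<noteq> inv_letter a) w"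

definition cyclically_reduced :: "word \<Rightarrow> bool" where
  "cyclically_reduced w \<longleftrightarrow> reduced w \<and> (w \<noteq> [] \<longrightarrow> hd w \<noteq> inv_letter (last w))"

fun reduce_Cons :: "letter \<Rightarrow> word \<Rightarrow> word" where
  "reduce_Cons a [] = [a]"
| "reduce_Cons a (b # w) = (if b = inv_letter a then w else a # b # w)"

definition reduce :: "word \<Rightarrow> word" where
  "reduce w = foldr reduce_Cons w []"

definition free_group :: "nat set \<Rightarrow> word monoid" where
  "free_group X = \<lparr>carrier = {w \<in> words X. reduced w}, mult = (\<lambda>u v. reduce (u @ v)), one = []\<rparr>"

lemma inv_letter_inv_letter [simp]: "inv_letter (inv_letter a) = a"
  by (simp add: inv_letter_def)

lemma reduced_Nil [simp]: "reduced []"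
  by (simp add: reduced_def)

lemma reduced_ConsD: "reduced (a # w) \<Longrightarrow> reduced w"
  by (cases w) (auto simp: reduced_def)

lemma reduced_reduce_Cons: "reduced w \<Longrightarrow> reduced (reduce_Cons a w)"
  by (cases w) (auto simp: reduced_def intro: reduced_ConsD[unfolded reduced_def])

lemma reduced_foldr: "reduced v \<Longrightarrow> reduced (foldr reduce_Cons u v)"
  by (induction u) (auto intro: reduced_reduce_Cons)

lemma reduced_reduce: "reduced (reduce w)"
  by (simp add: reduce_def reduced_foldr)

lemma reduce_reduced: "reduced w \<Longrightarrow> reduce w = w"
proof (induction w)
  case Nil
  then show ?case by (simp add: reduce_def)
next
  case (Cons a w)
  then have "reduce w = w" by (blast dest: reduced_ConsD)
  then show ?case using Cons.prems by (cases w) (auto simp: reduce_def reduced_def)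
qed

lemma reduce_Cons_inv:
  assumes "reduced w"
  shows "reduce_Cons (inv_letter a) (reduce_Cons a w) = w"
proof (cases w)
  case Nil
  then show ?thesis by simp
next
  case (Cons b v)
  then show ?thesis using assms by (cases v) (auto simp: reduced_def)
qed

lemma reduce_Cons_inv':
  assumes "reduced w"
  shows "reduce_Cons a (reduce_Cons (inv_letter a) w) = w"
  using reduce_Cons_inv[OF assms, of "inv_letter a"] by simp

lemma foldr_reduce_Cons_reduce_Cons:
  assumes "reduced v"
  shows "foldr reduce_Cons (reduce_Cons a u) v = reduce_Cons a (foldr reduce_Cons u v)"
  using assms by (cases u) (auto simp: reduce_Cons_inv' reduced_foldr)

lemma foldr_reduce: "reduced v \<Longrightarrow> foldr reduce_Cons (reduce u) v = foldr reduce_Cons u v"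
  by (induction u) (auto simp: reduce_def foldr_reduce_Cons_reduce_Cons)

lemma reduce_append: "reduce (u @ v) = foldr reduce_Cons u (reduce v)"
  by (simp add: reduce_def)

lemma set_reduce: "set (reduce w) \<subseteq> set w"
proof (induction w)
  case (Cons a w)
  have "set (reduce_Cons a v) \<subseteq> insert a (set v)" for v
    by (cases v) auto
  with Cons show ?case by (fastforce simp: reduce_def)
qed (simp add: reduce_def)

lemma reduce_in_words: "w \<in> words X \<Longrightarrow> reduce w \<in> words X"
  using set_reduce[of w] by (auto simp: words_def in_lists_conv_set)

lemma inv_word_cancel: "foldr reduce_Cons (inv_word w) (foldr reduce_Cons w []) = []"
proof (induction w)
  case (Cons a w)
  then show ?case by (simp add: inv_word_def reduce_Cons_inv reduced_foldr)
qed (simp add: inv_word_def)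

lemma group_free_group: "group (free_group X)"
proof (rule groupI)
  fix u v assume "u \<in> carrier (free_group X)" "v \<in> carrier (free_group X)"
  then show "u \<otimes>\<^bsub>free_group X\<^esub> v \<in> carrier (free_group X)"
    by (auto simp: free_group_def reduced_reduce intro!: reduce_in_words) (simp add: words_def)
next
  fix u v w
  have "reduce (reduce (u @ v) @ w) = foldr reduce_Cons (u @ v) (reduce w)"
    by (simp only: reduce_append[of "reduce (u @ v)" w] foldr_reduce reduced_reduce)
  also have "\<dots> = reduce (u @ reduce (v @ w))"
    by (simp add: reduce_append reduce_reduced reduced_foldr reduced_reduce)
  finally show "u \<otimes>\<^bsub>free_group X\<^esub> v \<otimes>\<^bsub>free_group X\<^esub> w =
      u \<otimes>\<^bsub>free_group X\<^esub> (v \<otimes>\<^bsub>free_group X\<^esub> w)"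
    by (simp add: free_group_def)
next
  fix u assume u: "u \<in> carrier (free_group X)"
  have "reduce (inv_word u) \<in> carrier (free_group X)"
    using u by (auto simp: free_group_def reduced_reduce intro!: reduce_in_words)
      (auto simp: words_def inv_word_def inv_letter_def in_lists_conv_set)
  moreover have "reduce (inv_word u) \<otimes>\<^bsub>free_group X\<^esub> u = \<one>\<^bsub>free_group X\<^esub>"
    using inv_word_cancel[of u]
    by (simp add: free_group_def reduce_append foldr_reduce reduced_reduce)
      (simp add: reduce_def)
  ultimately show "\<exists>v\<in>carrier (free_group X). v \<otimes>\<^bsub>free_group X\<^esub> u = \<one>\<^bsub>free_group X\<^esub>"
    by blast
qed (auto simp: free_group_def words_def reduce_reduced)


section \<open>Presentations\<close>

record presentation =
  gens :: "nat set"
  rels :: "word set"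

definition is_presentation :: "presentation \<Rightarrow> bool" where
  "is_presentation P \<longleftrightarrow>
    (\<forall>r\<in>rels P. r \<in> words (gens P) \<and> r \<noteq> [] \<and> cyclically_reduced r) \<and>
    (\<forall>r\<in>rels P. inv_word r \<in> rels P) \<and>
    (\<forall>u v. u @ v \<in> rels P \<longrightarrow> v @ u \<in> rels P)"

definition normal_closure :: "presentation \<Rightarrow> word set" where
  "normal_closure P = \<Inter>{N. N \<lhd> free_group (gens P) \<and> rels P \<subseteq> N}"

definition presented_group :: "presentation \<Rightarrow> word set monoid" where
  "presented_group P = free_group (gens P) Mod normal_closure P"

text \<open>Words need not be reduced; a word is evaluated in the free group by \<^const>\<open>reduce\<close>.\<close>

definition trivial_word :: "presentation \<Rightarrow> word \<Rightarrow> bool" where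
  "trivial_word P w \<longleftrightarrow> w \<in> words (gens P) \<and>
    normal_closure P #>\<^bsub>free_group (gens P)\<^esub> reduce w = \<one>\<^bsub>presented_group P\<^esub>"

definition word_code :: "word \<Rightarrow> nat" where
  "word_code w = list_encode (map (\<lambda>(x, e). prod_encode (x, of_bool e)) w)"

definition finitely_generated :: "presentation \<Rightarrow> bool" where
  "finitely_generated P \<longleftrightarrow> finite (gens P)"

definition decidable_presentation :: "presentation \<Rightarrow> bool" where
  "decidable_presentation P \<longleftrightarrow> decidable (gens P) \<and> decidable (word_code ` rels P)"

definition solvable_word_problem :: "presentation \<Rightarrow> bool" where
  "solvable_word_problem P \<longleftrightarrow> decidable (word_code ` {w. trivial_word P w})"


section \<open>Van Kampen diagrams\<close>

text \<open>
  A finite planar 2-complex is given by its combinatorial map.  Darts are oriented edges,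
  \<open>flip\<close> reverses a dart, and \<open>rot\<close> maps a dart to the next dart, in a fixed rotational direction,
  with the same origin.  Vertices, edges and faces are then the orbits of \<open>rot\<close>, of \<open>flip\<close> and of
  \<open>rot \<circ> flip\<close>; the latter sends a dart to its successor on the boundary walk of a face.
  A connected map with Euler characteristic 2 is a cell decomposition of the sphere.  The face
  through the dart \<open>base\<close> is the outer one, and deleting it leaves a connected and simply connected
  planar complex.  A map without darts denotes the complex consisting of a single vertex, which has
  no orbits; its \<open>base\<close> is irrelevant.
\<close>

record diagram =
  darts :: "nat set"
  flip :: "nat \<Rightarrow> nat"
  rot :: "nat \<Rightarrow> nat"
  lab :: "nat \<Rightarrow> letter"
  base :: nat

definition face_next :: "diagram \<Rightarrow> nat \<Rightarrow> nat" where
  "face_next D = rot D \<circ> flip D"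

definition vertices :: "diagram \<Rightarrow> nat set set" where
  "vertices D = orbit (rot D) ` darts D"

definition edges :: "diagram \<Rightarrow> nat set set" where
  "edges D = orbit (flip D) ` darts D"

definition faces :: "diagram \<Rightarrow> nat set set" where
  "faces D = orbit (face_next D) ` darts D"

definition planar_map :: "diagram \<Rightarrow> bool" where
  "planar_map D \<longleftrightarrow>
    finite (darts D) \<and>
    flip D permutes darts D \<and>
    (\<forall>d\<in>darts D. flip D d \<noteq> d \<and> flip D (flip D d) = d) \<and>
    rot D permutes darts D \<and>
    (\<forall>d\<in>darts D. \<forall>e\<in>darts D. (d, e) \<in> {(x, y). y = flip D x \<or> y = rot D x}\<^sup>*) \<and>
    (darts D \<noteq> {} \<longrightarrow>
      base D \<in> darts D \<and>
      card (vertices D) + card (faces D) = card (edges D) + 2)"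

definition face_label :: "diagram \<Rightarrow> nat \<Rightarrow> word" where
  "face_label D d =
    map (\<lambda>i. lab D ((face_next D ^^ i) d)) [0..<card (orbit (face_next D) d)]"

definition cells :: "diagram \<Rightarrow> nat set set" where
  "cells D = faces D - {orbit (face_next D) (base D)}"

definition area :: "diagram \<Rightarrow> nat" where
  "area D = card (cells D)"

definition boundary_label :: "diagram \<Rightarrow> word" where
  "boundary_label D = (if darts D = {} then [] else face_label D (base D))"

text \<open>
  Since the relators are closed under cyclic conjugation, it does not matter from which dart the
  boundary of a cell is read.  Mirror images and closure under inverses make the orientation of the
  boundary walks irrelevant, too.
\<close>

definition van_kampen_diagram :: "presentation \<Rightarrow> diagram \<Rightarrow> bool" where
  "van_kampen_diagram P D \<longleftrightarrow>
    planar_map D \<and>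
    (\<forall>d\<in>darts D. lab D d \<in> gens P \<times> UNIV \<and> lab D (flip D d) = inv_letter (lab D d)) \<and>
    (\<forall>c\<in>cells D. \<forall>d\<in>c. face_label D d \<in> rels P)"


section \<open>Bounded word problem and Dehn function\<close>

definition bounded_word_problem :: "presentation \<Rightarrow> (word \<times> nat) set" where
  "bounded_word_problem P = {(w, n). trivial_word P w \<and> n > 0 \<and>
    (\<exists>D. van_kampen_diagram P D \<and> boundary_label D = w \<and> area D \<le> n)}"

definition solvable_bounded_word_problem :: "presentation \<Rightarrow> bool" where
  "solvable_bounded_word_problem P \<longleftrightarrow>
    decidable ((\<lambda>(w, n). prod_encode (word_code w, list_encode (unary n))) `
      bounded_word_problem P)"

definition isoperimetric_function :: "presentation \<Rightarrow> (nat \<Rightarrow> nat) \<Rightarrow> bool" where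
  "isoperimetric_function P f \<longleftrightarrow> (\<forall>n w. trivial_word P w \<and> length w < n \<longrightarrow>
    (\<exists>D. van_kampen_diagram P D \<and> boundary_label D = w \<and> area D < f n))"

definition is_Dehn_function :: "presentation \<Rightarrow> (nat \<Rightarrow> nat) \<Rightarrow> bool" where
  "is_Dehn_function P f \<longleftrightarrow>
    isoperimetric_function P f \<and> (\<forall>g. isoperimetric_function P g \<longrightarrow> f \<le> g)"

lemma ex1_Dehn_function:
  assumes "isoperimetric_function P g"
  shows "\<exists>!f. is_Dehn_function P f"
proof -
  define f where "f n = (LEAST m. \<exists>h. isoperimetric_function P h \<and> h n = m)" for n
  have "\<exists>h. isoperimetric_function P h \<and> h n = f n" for n
    unfolding f_def by (rule LeastI_ex) (use assms in blast)
  then have "isoperimetric_function P f"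
    unfolding isoperimetric_function_def by metis
  moreover have "f \<le> h" if "isoperimetric_function P h" for h
    using that by (auto simp: le_fun_def f_def intro!: Least_le)
  ultimately have "is_Dehn_function P f"
    by (simp add: is_Dehn_function_def)
  then show ?thesis
    by (auto simp: is_Dehn_function_def intro: antisym)
qed

definition computable_function :: "(nat \<Rightarrow> nat) \<Rightarrow> bool" where
  "computable_function f \<longleftrightarrow>
    decidable (range (\<lambda>n. prod_encode (list_encode (binary n), list_encode (binary (f n)))))"

end

theory Submission
  imports Defs
begin

text \<open>
  Suppose first that the word problem and the bounded word problem are decidable, and let \<open>f\<close> be the
  Dehn function.  Since there are finitely many generators, there are finitely many words of length
  less than \<open>n\<close>; the word problem tells which of them are trivial, and the bounded word problem tells
  whether all of the latter bound diagrams of area at most a given positive number \<open>k\<close>, that is,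
  whether \<open>f n \<le> k + 1\<close>.  Because \<open>f\<close> exists, a search for the least such \<open>k\<close> terminates
  (\<open>computable_Dehn_function_max_2\<close>).

  As the area bound in the bounded word problem is positive, this search cannot separate area \<open>0\<close>
  from area \<open>1\<close>, so it computes \<open>max 2 (f n)\<close> only.  The gap is closed without any analysis of
  diagrams of area \<open>0\<close>: the Dehn function is monotone, so either it is at least \<open>2\<close> from some point
  on, or it is eventually constant.  In both cases it agrees with a computable function up to
  finitely many arguments, which makes it computable, though not uniformly in the presentation
  (\<open>computable_of_max_2\<close>).

  Conversely, suppose that the bounded word problem is decidable and that \<open>f\<close> is a computable
  isoperimetric function.  Then a word \<open>w\<close> is trivial if and only if \<open>(w, f (|w| + 1))\<close> belongs to the
  bounded word problem, which is decidable (\<open>solvable_word_problem_if_computable_bound\<close>).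

  Most of the text supplies the recursion theory: closure properties of the recursive functions,
  the computability of the codes of pairs, lists, unary and binary numerals, and the fact that a
  function is computable if and only if its graph, written in binary, is decidable
  (\<open>computable_function_iff\<close>).
\<close>

section \<open>Closure properties of the recursive functions\<close>

text \<open>
  The values of a recursive function on argument lists of the wrong length are artefacts of its
  construction.  Identifying functions that agree on lists of length \<open>k\<close> frees the closure
  properties below from these artefacts.
\<close>

definition computable :: "nat \<Rightarrow> (nat list \<Rightarrow> nat) \<Rightarrow> bool" where
  "computable k f \<longleftrightarrow> (\<exists>g. recursive k g \<and> (\<forall>xs. length xs = k \<longrightarrow> g xs = f xs))"

abbreviation computable1 :: "(nat \<Rightarrow> nat) \<Rightarrow> bool" where
  "computable1 f \<equiv> computable 1 (\<lambda>xs. f (xs ! 0))"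

abbreviation computable2 :: "(nat \<Rightarrow> nat \<Rightarrow> nat) \<Rightarrow> bool" where
  "computable2 f \<equiv> computable 2 (\<lambda>xs. f (xs ! 0) (xs ! 1))"

abbreviation computable3 :: "(nat \<Rightarrow> nat \<Rightarrow> nat \<Rightarrow> nat) \<Rightarrow> bool" where
  "computable3 f \<equiv> computable 3 (\<lambda>xs. f (xs ! 0) (xs ! 1) (xs ! 2))"

text \<open>
  The rules collected here are stated for functions of the form \<open>\<lambda>xs. h (a xs) (b xs)\<close>, so that
  resolution with them follows the structure of a term down to the projections.
\<close>

named_theorems computable_intros

lemma computableI:
  "recursive k g \<Longrightarrow> (\<And>xs. length xs = k \<Longrightarrow> g xs = f xs) \<Longrightarrow> computable k f"
  by (auto simp: computable_def)

lemma computable_proj [computable_intros]: "i < k \<Longrightarrow> computable k (\<lambda>xs. xs ! i)"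
  by (rule computableI, rule recursive.proj) simp_all

lemma computable_comp:
  assumes f: "computable (length gs) f" and gs: "\<And>g. g \<in> set gs \<Longrightarrow> computable k g"
  shows "computable k (\<lambda>xs. f (map (\<lambda>g. g xs) gs))"
proof -
  from f obtain f' where f': "recursive (length gs) f'"
      "\<And>xs. length xs = length gs \<Longrightarrow> f' xs = f xs"
    by (auto simp: computable_def)
  from gs obtain r where r: "\<And>g. g \<in> set gs \<Longrightarrow> recursive k (r g)"
      "\<And>g xs. g \<in> set gs \<Longrightarrow> length xs = k \<Longrightarrow> r g xs = g xs"
    unfolding computable_def by metis
  show ?thesis
  proof (rule computableI)
    show "recursive k (\<lambda>xs. f' (map (\<lambda>g. g xs) (map r gs)))"
      by (rule recursive.comp) (use f' r in auto)
  next
    fix xs :: "nat list" assume "length xs = k"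
    then show "f' (map (\<lambda>g. g xs) (map r gs)) = f (map (\<lambda>g. g xs) gs)"
      using r by (simp add: f'(2) comp_def cong: map_cong)
  qed
qed

lemma computable_comp1:
  assumes "computable1 f" "computable k a"
  shows "computable k (\<lambda>xs. f (a xs))"
  using computable_comp[of "[a]" "\<lambda>xs. f (xs ! 0)" k] assms by simp

lemma computable_comp2:
  assumes "computable2 f" "computable k a" "computable k b"
  shows "computable k (\<lambda>xs. f (a xs) (b xs))"
  using computable_comp[of "[a, b]" "\<lambda>xs. f (xs ! 0) (xs ! 1)" k] assms
  by (auto simp: numeral_2_eq_2)

lemma computable_Suc [computable_intros]:
  assumes "computable k a"
  shows "computable k (\<lambda>xs. Suc (a xs))"
  by (rule computable_comp1[OF _ assms], rule computableI, rule recursive.suc) simp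

lemma computable_const [computable_intros]: "computable k (\<lambda>_. n)"
proof (induction n)
  case 0
  show ?case by (rule computableI, rule recursive.zero) simp
qed (rule computable_Suc)

lemma computable1_rec_nat:
  assumes "computable2 g"
  shows "computable1 (rec_nat c g)"
proof -
  from assms obtain g' where g': "recursive 2 g'"
      "\<And>xs. length xs = 2 \<Longrightarrow> g' xs = g (xs ! 0) (xs ! 1)"
    by (auto simp: computable_def)
  from computable_const[of 0 c] obtain f' where f': "recursive 0 f'" "f' [] = c"
    by (auto simp: computable_def)
  show ?thesis
  proof (rule computableI)
    show "recursive 1 (\<lambda>xs. rec_nat (f' (tl xs)) (\<lambda>y r. g' (y # r # tl xs)) (hd xs))"
      using recursive.prec[of 0 f' g'] f' g' by (simp add: numeral_2_eq_2)
  next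
    fix xs :: "nat list" assume "length xs = 1"
    then obtain x where "xs = [x]" by (cases xs) auto
    then show "rec_nat (f' (tl xs)) (\<lambda>y r. g' (y # r # tl xs)) (hd xs) = rec_nat c g (xs ! 0)"
      using f' g' by simp
  qed
qed

lemma computable2_rec_nat:
  assumes "computable1 f" "computable3 g"
  shows "computable2 (\<lambda>n x. rec_nat (f x) (\<lambda>y r. g y r x) n)"
proof -
  from assms(2) obtain g' where g': "recursive 3 g'"
      "\<And>xs. length xs = 3 \<Longrightarrow> g' xs = g (xs ! 0) (xs ! 1) (xs ! 2)"
    by (auto simp: computable_def)
  from assms(1) obtain f' where f': "recursive 1 f'" "\<And>xs. length xs = 1 \<Longrightarrow> f' xs = f (xs ! 0)"
    by (auto simp: computable_def)
  show ?thesis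
  proof (rule computableI)
    show "recursive 2 (\<lambda>xs. rec_nat (f' (tl xs)) (\<lambda>y r. g' (y # r # tl xs)) (hd xs))"
      using recursive.prec[of 1 f' g'] f' g' by (simp add: numeral_2_eq_2 numeral_3_eq_3)
  next
    fix xs :: "nat list" assume "length xs = 2"
    then obtain n x where "xs = [n, x]"
      by (auto simp: numeral_2_eq_2 length_Suc_conv)
    then show "rec_nat (f' (tl xs)) (\<lambda>y r. g' (y # r # tl xs)) (hd xs) =
        rec_nat (f (xs ! 1)) (\<lambda>y r. g y r (xs ! 1)) (xs ! 0)"
      using f' g' by simp
  qed
qed

text \<open>
  Minimization is available in \<^const>\<open>recursive\<close> for the zeros of a function, whereas decided properties
  have the value \<open>1\<close>; primitive recursion supplies the function that swaps \<open>0\<close> and \<open>1\<close>.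
\<close>

lemma computable_mu:
  assumes f: "computable (Suc k) (\<lambda>xs. of_bool (P (hd xs) (tl xs)))"
    and ex: "\<And>xs. length xs = k \<Longrightarrow> \<exists>y. P y xs"
  shows "computable k (\<lambda>xs. LEAST y. P y xs)"
proof -
  have "computable1 (rec_nat 1 (\<lambda>_ _. 0))"
    by (intro computable1_rec_nat computable_intros)
  from computable_comp1[OF this f] obtain g where g: "recursive (Suc k) g"
      "\<And>xs. length xs = Suc k \<Longrightarrow> g xs = rec_nat 1 (\<lambda>_ _. 0) (of_bool (P (hd xs) (tl xs)) :: nat)"
    by (auto simp: computable_def)
  have g_iff: "g (y # xs) = 0 \<longleftrightarrow> P y xs" if "length xs = k" for y xs
    using that g(2)[of "y # xs"] by simp
  show ?thesis
    by (rule computableI, rule recursive.mu[OF g(1)]) (use ex in \<open>auto simp: g_iff\<close>)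
qed

lemma computable1_mu:
  assumes "computable2 (\<lambda>y x. of_bool (P y x))" "\<And>x. \<exists>y. P y x"
  shows "computable1 (\<lambda>x. LEAST y. P y x)"
proof (rule computable_mu)
  have "computable 2 (\<lambda>xs. of_bool (P (hd xs) (tl xs ! 0)))"
    using assms(1) unfolding computable_def
    by (auto simp: numeral_2_eq_2 length_Suc_conv all_conj_distrib)
  then show "computable (Suc 1) (\<lambda>xs. of_bool (P (hd xs) (tl xs ! 0)))"
    by (simp add: numeral_2_eq_2)
qed (use assms in auto)

lemma computable2_mu:
  assumes "computable3 (\<lambda>y x z. of_bool (P y x z))" "\<And>x z. \<exists>y. P y x z"
  shows "computable2 (\<lambda>x z. LEAST y. P y x z)"
proof (rule computable_mu)
  have "computable 3 (\<lambda>xs. of_bool (P (hd xs) (tl xs ! 0) (tl xs ! 1)))"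
    using assms(1) unfolding computable_def
    by (auto simp: numeral_2_eq_2 numeral_3_eq_3 length_Suc_conv)
  then show "computable (Suc 2) (\<lambda>xs. of_bool (P (hd xs) (tl xs ! 0) (tl xs ! 1)))"
    by (simp add: numeral_3_eq_3 numeral_2_eq_2)
qed (use assms in auto)

lemma decidable_iff_computable: "decidable A \<longleftrightarrow> computable1 (\<lambda>n. of_bool (n \<in> A))"
  unfolding decidable_def computable_def
  by (metis One_nat_def length_0_conv length_Suc_conv nth_Cons_0)

lemma computable_in [computable_intros]:
  "decidable A \<Longrightarrow> computable k a \<Longrightarrow> computable k (\<lambda>xs. of_bool (a xs \<in> A))"
  unfolding decidable_iff_computable by (rule computable_comp1)


section \<open>Arithmetic and bounded quantification\<close>

lemma computable_add [computable_intros]: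
  "computable k a \<Longrightarrow> computable k b \<Longrightarrow> computable k (\<lambda>xs. a xs + b xs)"
proof (rule computable_comp2[where f = "(+)"])
  have "computable2 (\<lambda>n x. rec_nat x (\<lambda>y r. Suc r) n)"
    by (intro computable2_rec_nat computable_intros) simp_all
  moreover have "rec_nat x (\<lambda>y. Suc) n = n + x" for n x :: nat
    by (induction n) auto
  ultimately show "computable2 (+)" by simp
qed

lemma computable_mult [computable_intros]:
  "computable k a \<Longrightarrow> computable k b \<Longrightarrow> computable k (\<lambda>xs. a xs * b xs)"
proof (rule computable_comp2[where f = "(*)"])
  have "computable2 (\<lambda>n x. rec_nat 0 (\<lambda>y r. x + r) n)"
    by (intro computable2_rec_nat computable_intros) simp_all
  moreover have "rec_nat 0 (\<lambda>y r. x + r) n = n * x" for n x :: nat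
    by (induction n) auto
  ultimately show "computable2 (*)" by simp
qed

lemma computable_diff [computable_intros]:
  assumes "computable k a" "computable k b"
  shows "computable k (\<lambda>xs. a xs - b xs)"
proof (rule computable_comp2[where f = "\<lambda>n x. x - n", OF _ assms(2,1)])
  have "computable1 (rec_nat 0 (\<lambda>y r. y))"
    by (intro computable1_rec_nat computable_intros) simp_all
  moreover have "rec_nat 0 (\<lambda>y r. y) n = n - 1" for n :: nat
    by (cases n) auto
  ultimately have "computable1 (\<lambda>n. n - 1)" by simp
  note pred = computable_comp1[OF this]
  have "computable2 (\<lambda>n x. rec_nat x (\<lambda>y r. r - 1) n)"
    by (intro computable2_rec_nat pred computable_intros) simp_all
  moreover have "rec_nat x (\<lambda>y r. r - 1) n = x - n" for n x :: nat
    by (induction n) auto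
  ultimately show "computable2 (\<lambda>n x. x - n)" by simp
qed

lemma computable_power [computable_intros]:
  assumes "computable k a"
  shows "computable k (\<lambda>xs. c ^ a xs)"
proof (rule computable_comp1[OF _ assms])
  have "computable1 (rec_nat 1 (\<lambda>y r. c * r))"
    by (intro computable1_rec_nat computable_intros) simp_all
  moreover have "rec_nat 1 (\<lambda>y r. c * r) n = c ^ n" for n
    by (induction n) auto
  ultimately show "computable1 ((^) c)" by simp
qed

lemma computable_le [computable_intros]:
  assumes "computable k a" "computable k b"
  shows "computable k (\<lambda>xs. of_bool (a xs \<le> b xs))"
proof -
  have "computable k (\<lambda>xs. 1 - (a xs - b xs))"
    by (intro computable_intros assms)
  moreover have "1 - (m - n) = of_bool (m \<le> n)" for m n :: nat by auto
  ultimately show ?thesis by simp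
qed

lemma computable_conj [computable_intros]:
  assumes "computable k (\<lambda>xs. of_bool (P xs))" "computable k (\<lambda>xs. of_bool (Q xs))"
  shows "computable k (\<lambda>xs. of_bool (P xs \<and> Q xs))"
  using computable_mult[OF assms] by (simp add: of_bool_conj)

lemma computable_not [computable_intros]:
  assumes "computable k (\<lambda>xs. of_bool (P xs))"
  shows "computable k (\<lambda>xs. of_bool (\<not> P xs))"
proof -
  have "computable k (\<lambda>xs. 1 - of_bool (P xs))"
    by (intro computable_intros assms)
  moreover have "1 - of_bool p = (of_bool (\<not> p) :: nat)" for p by simp
  ultimately show ?thesis by simp
qed

lemma computable_imp [computable_intros]:
  assumes "computable k (\<lambda>xs. of_bool (P xs))" "computable k (\<lambda>xs. of_bool (Q xs))"
  shows "computable k (\<lambda>xs. of_bool (P xs \<longrightarrow> Q xs))"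
proof -
  have "computable k (\<lambda>xs. of_bool (\<not> (P xs \<and> \<not> Q xs)))"
    by (intro computable_not computable_conj assms)
  then show ?thesis by simp
qed

lemma computable_eq [computable_intros]:
  assumes "computable k a" "computable k b"
  shows "computable k (\<lambda>xs. of_bool (a xs = b xs))"
proof -
  have "computable k (\<lambda>xs. of_bool (a xs \<le> b xs \<and> b xs \<le> a xs))"
    by (intro computable_intros assms)
  then show ?thesis by (simp add: order_eq_iff)
qed

lemma computable_less [computable_intros]:
  assumes "computable k a" "computable k b"
  shows "computable k (\<lambda>xs. of_bool (a xs < b xs))"
  using computable_not[OF computable_le[OF assms(2,1)]] by (simp add: not_le)

lemma computable_if [computable_intros]:
  assumes "computable k (\<lambda>xs. of_bool (P xs))" "computable k a" "computable k b"
  shows "computable k (\<lambda>xs. if P xs then a xs else b xs)"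
proof -
  have "computable k (\<lambda>xs. of_bool (P xs) * a xs + of_bool (\<not> P xs) * b xs)"
    by (intro computable_intros assms)
  moreover have "of_bool p * m + of_bool (\<not> p) * n = (if p then m else n)" for p and m n :: nat
    by simp
  ultimately show ?thesis by (simp only:)
qed

text \<open>
  The first counterexample or number beyond the bound always exists, so that unbounded minimization
  computes bounded quantifiers.
\<close>

lemma ball_le_iff_Least: "(\<forall>y\<le>b. P y) \<longleftrightarrow> b < (LEAST y. b < y \<or> \<not> P y)" for b :: nat
proof
  assume "\<forall>y\<le>b. P y"
  moreover have "b < (LEAST y. b < y \<or> \<not> P y) \<or> \<not> P (LEAST y. b < y \<or> \<not> P y)"
    by (rule LeastI[of _ "Suc b"]) simp
  ultimately show "b < (LEAST y. b < y \<or> \<not> P y)" using leI by blast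
next
  assume less: "b < (LEAST y. b < y \<or> \<not> P y)"
  show "\<forall>y\<le>b. P y"
  proof (intro allI impI)
    fix y assume "y \<le> b"
    with less have "y < (LEAST y. b < y \<or> \<not> P y)" by simp
    then show "P y" by (auto dest: not_less_Least)
  qed
qed

lemma computable2_ball:
  assumes P: "computable3 (\<lambda>y x z. of_bool (P y x z))" and b: "computable2 b"
  shows "computable2 (\<lambda>x z. of_bool (\<forall>y\<le>b x z. P y x z))"
  unfolding ball_le_iff_Least
proof (rule computable_less[OF b computable2_mu])
  have "computable3 (\<lambda>y x z. b x z)"
    by (rule computable_comp2[OF b]; rule computable_proj) simp_all
  then have "computable3 (\<lambda>y x z. of_bool (\<not> (y \<le> b x z \<and> P y x z)))"
    by (intro computable_intros P) simp_all
  then show "computable3 (\<lambda>y x z. of_bool (b x z < y \<or> \<not> P y x z))"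
    by (simp add: not_le)
qed (use lessI in blast)

text \<open>A finite table of exceptional values can be built into the algorithm, one value at a time.\<close>

lemma computable1_almost_equal:
  assumes g: "computable1 g" and eq: "\<And>n. N \<le> n \<Longrightarrow> f n = g n"
  shows "computable1 f"
  using assms
proof (induction N arbitrary: g)
  case 0
  then have "f = g" by auto
  with 0 show ?case by simp
next
  case (Suc N)
  have "computable1 (\<lambda>n. if n = N then f N else g n)"
    by (intro computable_intros Suc.prems) simp
  then show ?case
    by (rule Suc.IH) (use Suc.prems(2) le_Suc_eq Suc_leI in \<open>auto simp: le_less\<close>)
qed


section \<open>Codes of pairs and lists\<close>

lemma computable_prod_encode [computable_intros]:
  assumes "computable k a" "computable k b"
  shows "computable k (\<lambda>xs. prod_encode (a xs, b xs))"
proof -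
  have "computable1 (rec_nat 0 (\<lambda>y r. r + Suc y))"
    by (intro computable1_rec_nat computable_intros) simp_all
  moreover have "rec_nat 0 (\<lambda>y r. r + Suc y) n = triangle n" for n
    by (induction n) auto
  ultimately have "computable1 triangle" by simp
  note tri = computable_comp1[OF this]
  show ?thesis unfolding prod_encode_def prod.case
    by (intro tri computable_intros assms)
qed

lemma triangle_mono: "m \<le> n \<Longrightarrow> triangle m \<le> triangle n"
  by (induction n) (auto simp: le_Suc_eq)

lemma prod_encode_mono: "a \<le> a' \<Longrightarrow> b \<le> b' \<Longrightarrow> prod_encode (a, b) \<le> prod_encode (a', b')"
  by (simp add: prod_encode_def add_mono triangle_mono)

text \<open>
  The numbers from \<open>triangle s\<close> up to \<open>triangle (Suc s)\<close> exclusive code the pairs with sum \<open>s\<close>.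
  Finding the diagonal of a code is therefore a search, and the components follow by subtraction.
\<close>

lemma Least_diagonal: "(LEAST s. prod_encode (x, y) < triangle (Suc s)) = x + y"
proof (rule Least_equality)
  fix s assume "prod_encode (x, y) < triangle (Suc s)"
  then have "triangle (x + y) < triangle (Suc s)"
    by (simp add: prod_encode_def del: triangle_Suc)
  then have "\<not> Suc s \<le> x + y"
    using triangle_mono leD by blast
  then show "x + y \<le> s" by simp
qed (simp add: prod_encode_def)

lemma computable_fst_snd_prod_decode [computable_intros]:
  assumes "computable k a"
  shows "computable k (\<lambda>xs. fst (prod_decode (a xs)))" "computable k (\<lambda>xs. snd (prod_decode (a xs)))"
proof -
  define d where "d n = (LEAST s. n < triangle (Suc s))" for n
  \<comment> \<open>\<open>prod_encode (0, d n)\<close> is \<open>triangle (d n)\<close>, the first code on the diagonal \<open>d n\<close>\<close>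
  define q where "q n = n - prod_encode (0, d n)" for n
  have decode: "fst (prod_decode n) = q n \<and> snd (prod_decode n) = d n - q n" for n
  proof -
    obtain x y where n: "n = prod_encode (x, y)"
      by (metis prod_decode_inverse surj_pair)
    then have "d n = x + y" by (simp only: d_def Least_diagonal)
    then show ?thesis by (simp add: q_def n) (simp add: prod_encode_def)
  qed
  have "computable1 d" unfolding d_def
  proof (rule computable1_mu)
    have "computable2 (\<lambda>s n. of_bool (n < prod_encode (0, Suc s)))"
      by (intro computable_intros) simp_all
    then show "computable2 (\<lambda>s n. of_bool (n < triangle (Suc s)))"
      by (simp add: prod_encode_def)
    fix n
    show "\<exists>s. n < triangle (Suc s)" by (rule exI[of _ n]) simp
  qed
  note d = computable_comp1[OF this]
  show "computable k (\<lambda>xs. fst (prod_decode (a xs)))" "computable k (\<lambda>xs. snd (prod_decode (a xs)))"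
    unfolding decode[THEN conjunct1] decode[THEN conjunct2] q_def
    by (intro d computable_intros assms)+
qed

definition code_tl :: "nat \<Rightarrow> nat" where
  "code_tl n = snd (prod_decode (n - 1))"

lemma code_tl_list_encode: "code_tl (list_encode xs) = list_encode (tl xs)"
proof (cases xs)
  case Nil
  have "prod_encode (0, 0) = 0" by (simp add: prod_encode_def)
  then have "prod_decode 0 = (0, 0)" by (metis prod_encode_inverse)
  with Nil show ?thesis by (simp add: code_tl_def)
qed (simp add: code_tl_def)

definition code_length :: "nat \<Rightarrow> nat" where
  "code_length n = length (list_decode n)"

lemma code_length_list_encode [simp]: "code_length (list_encode xs) = length xs"
  by (simp add: code_length_def)

text \<open>The length of a list is the number of tails to be taken until the code \<open>0\<close> of the empty list appears.\<close>

lemma computable_code_length [computable_intros]: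
  assumes "computable k a"
  shows "computable k (\<lambda>xs. code_length (a xs))"
proof (rule computable_comp1[OF _ assms])
  define t where "t i n = rec_nat n (\<lambda>_ r. code_tl r) i" for i n
  have t: "t i (list_encode xs) = list_encode (drop i xs)" for i xs
    by (induction i) (simp_all add: t_def code_tl_list_encode drop_Suc tl_drop)
  have t0: "t i n = 0 \<longleftrightarrow> code_length n \<le> i" for i n
  proof -
    have "list_encode ys = 0 \<longleftrightarrow> ys = []" for ys
      by (cases ys) simp_all
    then show ?thesis
      using t[of i "list_decode n"] by (simp add: code_length_def)
  qed
  have "code_length n = (LEAST i. t i n = 0)" for n
    unfolding t0 by (rule Least_equality[symmetric]) simp_all
  moreover have "computable1 (\<lambda>n. LEAST i. t i n = 0)"
  proof (rule computable1_mu)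
    have "computable2 t" unfolding t_def code_tl_def
      by (intro computable2_rec_nat computable_intros) simp_all
    then show "computable2 (\<lambda>i n. of_bool (t i n = 0))"
      by (rule computable_eq) (rule computable_const)
  next
    show "\<exists>i. t i n = 0" for n unfolding t0 by blast
  qed
  ultimately show "computable1 code_length" by (simp only:)
qed

lemma computable_unary [computable_intros]:
  assumes "computable k a"
  shows "computable k (\<lambda>xs. list_encode (unary (a xs)))"
proof (rule computable_comp1[OF _ assms])
  have "computable1 (rec_nat 0 (\<lambda>y r. Suc (prod_encode (1, r))))"
    by (intro computable1_rec_nat computable_intros) simp_all
  moreover have "rec_nat 0 (\<lambda>y r. Suc (prod_encode (1, r))) n = list_encode (unary n)" for n
    by (induction n) (auto simp: unary_def)
  ultimately show "computable1 (\<lambda>n. list_encode (unary n))" by simp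
qed

section \<open>Binary numerals and computable graphs\<close>

lemma computable_div2:
  assumes "computable k a"
  shows "computable k (\<lambda>xs. a xs div 2)"
proof (rule computable_comp1[OF _ assms])
  have "(n::nat) div 2 = (LEAST q. n \<le> 2 * q + 1)" for n
    by (rule Least_equality[symmetric]) auto
  moreover have "computable1 (\<lambda>n. LEAST q. n \<le> 2 * q + 1)"
  proof (rule computable1_mu)
    show "computable2 (\<lambda>q n. of_bool (n \<le> 2 * q + 1))"
      by (intro computable_intros) simp_all
    show "\<exists>q. n \<le> 2 * q + 1" for n :: nat
      by (rule exI[of _ n]) simp
  qed
  ultimately show "computable1 (\<lambda>n. n div 2)" by (simp only:)
qed

text \<open>
  \<^const>\<open>binary\<close> appends digits at the end, which is awkward on codes.  The step below moves the last
  digit of the remaining number \<open>n\<close> to the front of the code \<open>c\<close> of the digits found so far.  It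
  stops while one digit remains, so the code of the numeral is obtained by prepending \<open>n\<close> to \<open>c\<close>.
\<close>

definition binary_step :: "nat \<times> nat \<Rightarrow> nat \<times> nat" where
  "binary_step = (\<lambda>(n, c). if n < 2 then (n, c) else (n div 2, Suc (prod_encode (n mod 2, c))))"

text \<open>
  Since stopped states are fixed points, any number of steps that is large enough will do; \<open>n\<close> steps
  are a convenient choice.
\<close>

lemma binary_step_funpow:
  "n \<le> Suc m \<Longrightarrow> \<exists>d ds. (binary_step ^^ m) (n, list_encode xs) = (d, list_encode ds) \<and>
     d # ds = binary n @ xs"
proof (induction m arbitrary: n xs)
  case 0
  then show ?case by (simp add: binary.simps)
next
  case (Suc m)
  show ?case
  proof (cases "n < 2")
    case True
    then have "(binary_step ^^ i) (n, c) = (n, c)" for i c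
      by (induction i) (simp_all add: binary_step_def)
    with True show ?thesis by (simp add: binary.simps del: funpow.simps)
  next
    case False
    have "(binary_step ^^ Suc m) (n, list_encode xs) =
        (binary_step ^^ m) (n div 2, list_encode ((n mod 2) # xs))"
      using False by (simp add: funpow_Suc_right binary_step_def del: funpow.simps)
    moreover have "n div 2 \<le> Suc m" using Suc.prems by simp
    ultimately show ?thesis
      using Suc.IH[of "n div 2" "(n mod 2) # xs"] False by (simp add: binary.simps[of n])
  qed
qed

lemma computable_binary [computable_intros]:
  assumes "computable k a"
  shows "computable k (\<lambda>xs. list_encode (binary (a xs)))"
proof (rule computable_comp1[OF _ assms])
  define s where "s i n = rec_nat (prod_encode (n, 0)) (\<lambda>_ r. prod_encode (binary_step (prod_decode r))) i"
    for i n
  have s: "s i n = prod_encode ((binary_step ^^ i) (n, 0))" for i n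
    by (induction i) (simp_all add: s_def)
  have bin: "list_encode (binary n) = Suc (s n n)" for n
    using binary_step_funpow[of n n "[]"] by (auto simp: s simp flip: list_encode.simps(2))
  have step: "prod_encode (binary_step (prod_decode r)) =
    (if fst (prod_decode r) < 2 then r else prod_encode (fst (prod_decode r) div 2,
       Suc (prod_encode (fst (prod_decode r) - 2 * (fst (prod_decode r) div 2), snd (prod_decode r)))))" for r
    by (simp add: binary_step_def split_def minus_mult_div_eq_mod)
  have "computable2 s" unfolding s_def step
    by (intro computable2_rec_nat computable_intros computable_div2) simp_all
  then show "computable1 (\<lambda>n. list_encode (binary n))"
    unfolding bin by (rule computable_Suc[OF computable_comp2]) (rule computable_proj, simp)+
qed

text \<open>Horner's scheme recovers a number from its digits.\<close>

lemma inj_binary: "inj binary"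
proof (rule inj_on_inverseI)
  show "foldl (\<lambda>v d. 2 * v + d) 0 (binary n) = n" for n
  proof (induction n rule: binary.induct)
    case (1 n)
    show ?case
    proof (cases "n < 2")
      case False
      with 1 show ?thesis by (subst binary.simps) simp
    qed (simp add: binary.simps)
  qed
qed

lemma less_power_length_binary: "n < 2 ^ length (binary n)"
proof (induction n rule: binary.induct)
  case (1 n)
  show ?case
  proof (cases "n < 2")
    case False
    with 1 show ?thesis by (subst binary.simps) simp
  qed (simp add: binary.simps)
qed

lemma binary_code_eq_iff [simp]: "list_encode (binary m) = list_encode (binary n) \<longleftrightarrow> m = n"
  by (simp add: list_encode_eq inj_eq[OF inj_binary])

text \<open>
  From a decidable graph, \<open>f n\<close> is found by searching for the \<open>m\<close> with \<open>(n, m)\<close> in the graph.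
  For the converse, a code \<open>c\<close> of a pair of strings has to be tested for being the code of the
  numerals of \<open>n\<close> and \<open>f n\<close> for some \<open>n\<close>.  Only numbers with as many digits as the first string
  has symbols can occur, so finitely many candidates are tested and no numeral has to be parsed.
\<close>

lemma computable_function_iff: "computable_function f \<longleftrightarrow> computable1 f"
proof
  let ?b = "\<lambda>n. list_encode (binary n)"
  let ?G = "range (\<lambda>n. prod_encode (?b n, ?b (f n)))"
  {
    assume "computable_function f"
    then have G: "decidable ?G" by (simp add: computable_function_def)
    have G_iff: "prod_encode (?b n, ?b m) \<in> ?G \<longleftrightarrow> m = f n" for m n
      by auto
    have "computable1 (\<lambda>n. LEAST m. prod_encode (?b n, ?b m) \<in> ?G)"
    proof (rule computable1_mu)
      show "computable2 (\<lambda>m n. of_bool (prod_encode (?b n, ?b m) \<in> ?G))"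
        by (intro computable_intros G) simp_all
    qed (use G_iff in blast)
    then show "computable1 f" unfolding G_iff by (simp add: Least_equality)
  next
    assume f: "computable1 f"
    have G_iff: "c \<in> ?G \<longleftrightarrow>
      \<not> (\<forall>n\<le>2 ^ code_length (fst (prod_decode c)). prod_encode (?b n, ?b (f n)) \<noteq> c)" for c
    proof
      assume "c \<in> ?G"
      then obtain n where n: "c = prod_encode (?b n, ?b (f n))" by blast
      then have "n \<le> 2 ^ code_length (fst (prod_decode c))"
        using less_power_length_binary[of n] by simp
      with n show "\<not> (\<forall>n\<le>2 ^ code_length (fst (prod_decode c)). prod_encode (?b n, ?b (f n)) \<noteq> c)"
        by blast
    qed auto
    have "computable3 (\<lambda>n c z. of_bool (\<not> prod_encode (?b n, ?b (f n)) = c))"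
      by (intro computable_intros computable_comp1[OF f]) simp_all
    then have "computable2 (\<lambda>c z. of_bool
        (\<forall>n\<le>2 ^ code_length (fst (prod_decode c)). prod_encode (?b n, ?b (f n)) \<noteq> c))"
      by (rule computable2_ball) (intro computable_intros, simp)
    \<comment> \<open>the second argument is a dummy: bounded quantification was proved for two parameters\<close>
    from computable_comp2[OF this, of 1 "\<lambda>xs. xs ! 0" "\<lambda>xs. xs ! 0"]
    have "computable1 (\<lambda>c. of_bool (c \<in> ?G))"
      unfolding G_iff by (intro computable_intros) (simp add: computable_proj)
    then show "computable_function f"
      by (simp add: computable_function_def decidable_iff_computable)
  }
qed

section \<open>Codes of words\<close>

lemma inj_word_code: "inj word_code"
proof (rule injI)
  fix v w assume "word_code v = word_code w"
  then have "map (\<lambda>(x, e). prod_encode (x, of_bool e)) v = map (\<lambda>(x, e). prod_encode (x, of_bool e)) w"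
    by (simp add: word_code_def list_encode_eq)
  moreover have "inj (\<lambda>(x, e :: bool). prod_encode (x, of_bool e))"
    by (auto simp: inj_def prod_encode_eq)
  ultimately show "v = w" by (metis inj_map_eq_map)
qed

lemma code_length_word_code: "code_length (word_code w) = length w"
  by (simp add: word_code_def)

lemma inj_unary: "inj unary"
  by (metis injI length_replicate unary_def)

text \<open>
  The code of a list is monotone in its entries, and prepending an entry increases it; hence the
  list of \<open>n\<close> entries equal to \<open>c\<close> has the largest code among the lists of at most \<open>n\<close> entries up
  to \<open>c\<close>.
\<close>

lemma bounded_list_encode:
  obtains B where "computable1 B" "\<And>n xs. set xs \<subseteq> {..c} \<Longrightarrow> length xs \<le> n \<Longrightarrow> list_encode xs \<le> B n"
proof
  define B where "B = rec_nat 0 (\<lambda>_ r. Suc (prod_encode (c, r)))"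
  show "computable1 B" unfolding B_def
    by (intro computable1_rec_nat computable_intros) simp_all
  show "list_encode xs \<le> B n" if "set xs \<subseteq> {..c}" "length xs \<le> n" for n xs
    using that
  proof (induction n arbitrary: xs)
    case (Suc n)
    then show ?case by (cases xs) (auto simp: B_def intro: prod_encode_mono)
  qed simp
qed

lemma bounded_word_code:
  assumes "finite X"
  obtains B where "computable1 B" "\<And>n w. w \<in> words X \<Longrightarrow> length w \<le> n \<Longrightarrow> word_code w \<le> B n"
proof -
  let ?e = "\<lambda>(x, e). prod_encode (x, of_bool e)"
  have "finite (?e ` (X \<times> UNIV))" using assms by simp
  then obtain c where c: "?e ` (X \<times> UNIV) \<subseteq> {..c}"
    unfolding finite_nat_set_iff_bounded_le by blast
  obtain B where B: "computable1 B"
    "\<And>n xs. set xs \<subseteq> {..c} \<Longrightarrow> length xs \<le> n \<Longrightarrow> list_encode xs \<le> B n"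
    using bounded_list_encode[of c] by metis
  show ?thesis
  proof (rule that[OF B(1)])
    fix n w assume "w \<in> words X" "length w \<le> n"
    then show "word_code w \<le> B n"
      unfolding word_code_def by (intro B(2)) (use c in \<open>auto simp: words_def\<close>)
  qed
qed

section \<open>Dehn functions and word problems\<close>

abbreviation bounded_code :: "nat \<Rightarrow> nat \<Rightarrow> nat" where
  "bounded_code c n \<equiv> prod_encode (c, list_encode (unary n))"

abbreviation bounded_codes :: "presentation \<Rightarrow> nat set" where
  "bounded_codes P \<equiv> (\<lambda>(w, n). bounded_code (word_code w) n) ` bounded_word_problem P"

lemma bounded_code_in_iff:
  "bounded_code (word_code w) n \<in> bounded_codes P \<longleftrightarrow> (w, n) \<in> bounded_word_problem P"
  by (auto simp: prod_encode_eq list_encode_eq inj_eq[OF inj_word_code] inj_eq[OF inj_unary])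

text \<open>
  Minimality among isoperimetric functions is pointwise minimality: lowering the value at a single
  \<open>n\<close> as far as the words shorter than \<open>n\<close> permit leaves an isoperimetric function.
\<close>

lemma Dehn_function_le_iff:
  assumes "is_Dehn_function P f"
  shows "f n \<le> m \<longleftrightarrow> (\<forall>w. trivial_word P w \<and> length w < n \<longrightarrow>
    (\<exists>D. van_kampen_diagram P D \<and> boundary_label D = w \<and> area D < m))"
proof
  have f: "isoperimetric_function P f" using assms by (simp add: is_Dehn_function_def)
  then show "f n \<le> m \<Longrightarrow> \<forall>w. trivial_word P w \<and> length w < n \<longrightarrow>
    (\<exists>D. van_kampen_diagram P D \<and> boundary_label D = w \<and> area D < m)"
    unfolding isoperimetric_function_def by (meson order_less_le_trans)
  assume "\<forall>w. trivial_word P w \<and> length w < n \<longrightarrow>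
    (\<exists>D. van_kampen_diagram P D \<and> boundary_label D = w \<and> area D < m)"
  with f have "isoperimetric_function P (f(n := m))"
    by (simp add: isoperimetric_function_def)
  then have "f \<le> f(n := m)" using assms by (simp add: is_Dehn_function_def)
  then show "f n \<le> m" by (auto dest: le_funD[of _ _ n])
qed

lemma mono_Dehn_function:
  assumes "is_Dehn_function P f"
  shows "mono f"
proof (rule monoI)
  fix m n :: nat assume "m \<le> n"
  moreover have "f n \<le> f n" ..
  ultimately show "f m \<le> f n"
    unfolding Dehn_function_le_iff[OF assms] by (meson order_less_le_trans)
qed

text \<open>
  The offset \<open>2\<close> arises because areas are strictly below the Dehn function, and because the
  bounded word problem admits positive bounds only.
\<close>

lemma Dehn_function_le_add_2_iff:
  assumes "is_Dehn_function P f"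
  shows "f n \<le> k + 2 \<longleftrightarrow> (\<forall>w. trivial_word P w \<and> length w < n \<longrightarrow> (w, Suc k) \<in> bounded_word_problem P)"
  unfolding Dehn_function_le_iff[OF assms] by (auto simp: bounded_word_problem_def less_Suc_eq_le)

text \<open>
  The inequality of the preceding equivalence becomes decidable in \<open>n\<close> and \<open>k\<close> once the quantifier
  over trivial words of length less than \<open>n\<close> is bounded, and then the least \<open>k\<close> can be searched for.
  It equals \<open>f n - 2\<close>, truncated at \<open>0\<close>.
\<close>

lemma computable_Dehn_function_max_2:
  assumes fin: "finitely_generated P" and W: "solvable_word_problem P"
    and V: "solvable_bounded_word_problem P" and f: "is_Dehn_function P f"
  shows "computable1 (\<lambda>n. max 2 (f n))"
proof -
  let ?W = "word_code ` {w. trivial_word P w}"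
  obtain B where B: "computable1 B"
      "\<And>n w. w \<in> words (gens P) \<Longrightarrow> length w \<le> n \<Longrightarrow> word_code w \<le> B n"
    using bounded_word_code fin unfolding finitely_generated_def by blast
  have iff: "f n \<le> k + 2 \<longleftrightarrow>
    (\<forall>c\<le>B n. c \<in> ?W \<and> code_length c < n \<longrightarrow> bounded_code c (Suc k) \<in> bounded_codes P)" for n k
  proof -
    have "f n \<le> k + 2 \<longleftrightarrow>
        (\<forall>w. trivial_word P w \<and> length w < n \<longrightarrow> bounded_code (word_code w) (Suc k) \<in> bounded_codes P)"
      unfolding Dehn_function_le_add_2_iff[OF f] bounded_code_in_iff ..
    also have "\<dots> \<longleftrightarrow> (\<forall>c\<in>?W. code_length c < n \<longrightarrow> bounded_code c (Suc k) \<in> bounded_codes P)"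
      by (auto simp: code_length_word_code)
    also have "\<dots> \<longleftrightarrow>
      (\<forall>c\<le>B n. c \<in> ?W \<and> code_length c < n \<longrightarrow> bounded_code c (Suc k) \<in> bounded_codes P)"
    proof -
      have "c \<le> B n" if "c \<in> ?W" "code_length c < n" for c
        using that by (auto simp: code_length_word_code trivial_word_def intro!: B(2))
      then show ?thesis by blast
    qed
    finally show ?thesis .
  qed
  have "computable2 (\<lambda>k n. of_bool (f n \<le> k + 2))"
    unfolding iff
    by (intro computable2_ball computable_intros computable_comp1[OF B(1)]
        W[unfolded solvable_word_problem_def] V[unfolded solvable_bounded_word_problem_def])
      simp_all
  then have "computable1 (\<lambda>n. LEAST k. f n \<le> k + 2)"
    by (rule computable1_mu) (metis le_add1)
  then have "computable1 (\<lambda>n. (LEAST k. f n \<le> k + 2) + 2)"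
    by (intro computable_intros)
  moreover have "(LEAST k. f n \<le> k + 2) = f n - 2" for n
    by (rule Least_equality) auto
  moreover have "m - 2 + 2 = max 2 m" for m :: nat by simp
  ultimately show ?thesis by simp
qed

text \<open>
  A monotone function either reaches \<open>2\<close>, and then agrees with \<open>max 2 (f n)\<close> from that point on, or
  it is bounded and therefore eventually constant.
\<close>

lemma computable_of_max_2:
  assumes "mono f" "computable1 (\<lambda>n. max 2 (f n))"
  shows "computable1 f"
proof -
  obtain N where N: "f N \<ge> 2 \<or> (\<forall>n\<ge>N. f n = f N)"
  proof (cases "\<exists>n. f n \<ge> 2")
    case False
    obtain N where "\<And>n. f n \<le> f N"
      using False ex_has_greatest_nat[of "\<lambda>_. True" 0 f 2] by (auto simp: not_le)
    then have "\<forall>n\<ge>N. f n = f N" using assms(1) by (simp add: mono_def order_antisym)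
    then show ?thesis using that by blast
  qed (use that in blast)
  then show ?thesis
  proof
    assume "f N \<ge> 2"
    then have "f n = max 2 (f n)" if "n \<ge> N" for n
      using monoD[OF assms(1) that] by simp
    then show ?thesis
      by (rule computable1_almost_equal[OF assms(2)])
  next
    assume "\<forall>n\<ge>N. f n = f N"
    then have "f n = f N" if "n \<ge> N" for n
      using that by blast
    then show ?thesis
      by (rule computable1_almost_equal[OF computable_const])
  qed
qed

text \<open>
  The argument \<open>|w| + 1\<close> is the least one for which an isoperimetric function says something about
  \<open>w\<close>.  A diagram exists with area strictly below the bound, so the bound is positive, as the
  bounded word problem demands.  Conversely, all words of the bounded word problem are trivial.
\<close>

lemma solvable_word_problem_if_computable_bound:
  assumes V: "solvable_bounded_word_problem P" and iso: "isoperimetric_function P f"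
    and f: "computable1 f"
  shows "solvable_word_problem P"
proof -
  let ?W = "word_code ` {w. trivial_word P w}"
  have "c \<in> ?W \<longleftrightarrow> bounded_code c (f (Suc (code_length c))) \<in> bounded_codes P" for c
  proof
    assume "c \<in> ?W"
    then obtain w where w: "trivial_word P w" "c = word_code w" by blast
    with iso obtain D where "van_kampen_diagram P D" "boundary_label D = w"
        "area D < f (Suc (length w))"
      unfolding isoperimetric_function_def by blast
    with w have "(w, f (Suc (length w))) \<in> bounded_word_problem P"
      by (auto simp: bounded_word_problem_def intro: less_imp_le)
    then show "bounded_code c (f (Suc (code_length c))) \<in> bounded_codes P"
      unfolding w(2) bounded_code_in_iff by (simp add: code_length_word_code)
  next
    assume "bounded_code c (f (Suc (code_length c))) \<in> bounded_codes P"
    then show "c \<in> ?W"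
      by (auto simp: prod_encode_eq bounded_word_problem_def)
  qed
  moreover have "computable1 (\<lambda>c. of_bool (bounded_code c (f (Suc (code_length c))) \<in> bounded_codes P))"
    by (intro computable_intros computable_comp1[OF f] V[unfolded solvable_bounded_word_problem_def])
      simp_all
  ultimately show ?thesis
    by (simp add: solvable_word_problem_def decidable_iff_computable)
qed

lemma computable_Dehn_function:
  assumes "finitely_generated P" "solvable_word_problem P" "solvable_bounded_word_problem P"
    and "is_Dehn_function P f"
  shows "computable1 f"
  using assms by (blast intro: computable_of_max_2 mono_Dehn_function computable_Dehn_function_max_2)

theorem lemma1:
  shows "(\<nexists>P. is_presentation P \<and> finitely_generated P \<and> decidable_presentation P \<and>
            solvable_word_problem P \<and> solvable_bounded_word_problem P \<and>
            (\<exists>f. is_Dehn_function P f \<and> \<not> computable_function f)) \<and>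
         (\<nexists>P. is_presentation P \<and> finitely_generated P \<and> decidable_presentation P \<and>
            \<not> solvable_word_problem P \<and> solvable_bounded_word_problem P \<and>
            (\<exists>f. is_Dehn_function P f \<and> computable_function f))"
proof (intro conjI notI; elim exE conjE)
  fix P f
  assume "finitely_generated P" "solvable_word_problem P" "solvable_bounded_word_problem P"
    and "is_Dehn_function P f" "\<not> computable_function f"
  then show False
    using computable_Dehn_function computable_function_iff by auto
next
  fix P f
  assume "\<not> solvable_word_problem P" "solvable_bounded_word_problem P"
    and "is_Dehn_function P f" "computable_function f"
  then show False
    using solvable_word_problem_if_computable_bound
    by (auto simp: is_Dehn_function_def computable_function_iff)
qed

end
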